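(* Let $T\subset\mathbb{R}^n$ be an ellipsoid (the bounded open body bounded by an ellipsoidal hypersurface), and let $K\subset\mathbb{R}^n$ be a convex bounded open subset with smooth boundary. Then: 1) the $T$-billiard reflection $R_K=(R_{K,q})_{q\in\partial K}$ is the reflection defined by a projective billiard structure on $\partial K$: there exists a transversal line field $\mathcal N$ on $\partial K$ such that for every $q\in\partial K$ the map $R_{K,q}$ is the restriction to the lines directed out of $K$ at $q$ of the projective billiard reflection involution at $q$ defined by $(\partial K,\mathcal N)$; 2) this projective billiard structure on $\partial K$ is affinely Euclidean.
   Context: Reflection $R_{K,q}$. For $q\in\partial K$ let $\vec n(q)$ be the exterior unit normal to $\partial K$ at $q$, and for $p\in\partial T$ let $\vec n(p)$ be the exterior unit normal to $\partial T$ at $p$. An oriented line through $q$ with direction vector $u$ is directed out of $K$ at $q$ if $\langle u,\vec n(q)\rangle>0$ and directed inside $K$ if $\langle u,\vec n(q)\rangle<0$. The map $R_{K,q}$ sends an oriented line $L_0$ through $q$ directed out of $K$ to an oriented line $L_1$ through $q$ directed inside $K$ as follows: let $p_0\in\partial T$ be the unique point such that $\vec n(p_0)$ is parallel to and co-directed with $L_0$; let $p_1\ne p_0$ be the second intersection point with $\partial T$ of the ray issued from $p_0$ in the direction $-\vec n(q)$; then $L_1$ is the oriented line through $q$ directed by $\vec n(p_1)$. Projective billiard. A projective billiard is a smooth hypersurface $C\subset\mathbb{R}^n$ equipped with a transversal line field $\mathcal N$ (for each $Q\in C$, $\mathcal N(Q)$ is a line through $Q$ transversal to the tangent hyperplane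 $T_QC$). Its reflection involution at $Q\in C$ acts on the oriented lines through $Q$ by the affine involution $\mathbb{R}^n\to\mathbb{R}^n$ that fixes every point of the tangent hyperplane to $C$ at $Q$, preserves the line $\mathcal N(Q)$ and acts on $\mathcal N(Q)$ as the central symmetry with respect to $Q$. A projective billiard $(C,\mathcal N)$ in $\mathbb{R}^n$ is affinely Euclidean if there exists an affine transformation $F:\mathbb{R}^n\to\mathbb{R}^n$ such that the image of $\mathcal N$ under the differential $dF$ is the (Euclidean) normal line field to $F(C)$; equivalently, $F$ transforms it to the usual Euclidean billiard on $F(C)$. *)

theory Defs
  imports "HOL-Analysis.Analysis"
begin

section \<open>Smooth hypersurfaces, tangent and normal spaces\<close>

text \<open>Used for open \<open>U\<close> only.\<close>

primrec Ck_on :: "nat \<Rightarrow> ('a::euclidean_space \<Rightarrow> real) \<Rightarrow> 'a set \<Rightarrow> bool" where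
  "Ck_on 0 f U \<longleftrightarrow> continuous_on U f"
| "Ck_on (Suc k) f U \<longleftrightarrow>
     (\<forall>x\<in>U. f differentiable (at x)) \<and>
     (\<forall>v. Ck_on k (\<lambda>x. frechet_derivative f (at x) v) U)"

definition smooth_on :: "'a::euclidean_space set \<Rightarrow> ('a \<Rightarrow> real) \<Rightarrow> bool" where
  "smooth_on U f \<longleftrightarrow> (\<forall>k. Ck_on k f U)"

definition smooth_hypersurface :: "'a::euclidean_space set \<Rightarrow> bool" where
  "smooth_hypersurface C \<longleftrightarrow>
     (\<forall>q\<in>C. \<exists>U \<rho>. open U \<and> q \<in> U \<and> smooth_on U \<rho> \<and>
        C \<inter> U = {x\<in>U. \<rho> x = 0} \<and>
        (\<forall>x\<in>C \<inter> U. frechet_derivative \<rho> (at x) \<noteq> (\<lambda>v. 0)))"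

text \<open>Velocity vectors at \<open>q\<close> of curves in \<open>C\<close>. On a smooth hypersurface, curves that are
  merely differentiable at the base point have the same velocities as smooth ones.\<close>

definition tangent_space :: "'a::euclidean_space set \<Rightarrow> 'a \<Rightarrow> 'a set" where
  "tangent_space C q =
     {v. \<exists>\<gamma> \<epsilon>. \<epsilon> > 0 \<and> (\<forall>t::real. \<bar>t\<bar> < \<epsilon> \<longrightarrow> \<gamma> t \<in> C) \<and> \<gamma> 0 = q \<and>
          (\<gamma> has_vector_derivative v) (at 0)}"

definition tangent_hyperplane :: "'a::euclidean_space set \<Rightarrow> 'a \<Rightarrow> 'a set" where
  "tangent_hyperplane C q = (+) q ` tangent_space C q"

definition normal_line :: "'a::euclidean_space set \<Rightarrow> 'a \<Rightarrow> 'a set" where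
  "normal_line C q = (+) q ` orthogonal_comp (tangent_space C q)"

definition exterior_unit_normal :: "'a::euclidean_space set \<Rightarrow> 'a \<Rightarrow> 'a" where
  "exterior_unit_normal K q =
     (THE n. norm n = 1 \<and> n \<in> orthogonal_comp (tangent_space (frontier K) q) \<and>
        (\<exists>\<epsilon>>0. \<forall>t. 0 < t \<and> t < \<epsilon> \<longrightarrow> q + t *\<^sub>R n \<notin> closure K))"


section \<open>Affine transformations and ellipsoids\<close>

definition affine_map :: "('a::euclidean_space \<Rightarrow> 'a) \<Rightarrow> bool" where
  "affine_map F \<longleftrightarrow> (\<exists>A b. linear A \<and> F = (\<lambda>x. A x + b))"

definition affine_transformation :: "('a::euclidean_space \<Rightarrow> 'a) \<Rightarrow> bool" where
  "affine_transformation F \<longleftrightarrow> affine_map F \<and> bij F"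

text \<open>The open solid body, not its boundary hypersurface.\<close>

definition ellipsoid :: "'a::euclidean_space set \<Rightarrow> bool" where
  "ellipsoid T \<longleftrightarrow> (\<exists>F. affine_transformation F \<and> T = F ` ball 0 1)"


section \<open>Oriented lines\<close>

text \<open>An oriented line is encoded by the strict order it carries on its points: the pair
  \<open>(x, y)\<close> belongs to it iff \<open>x\<close> and \<open>y\<close> are points of the line and \<open>x\<close> precedes \<open>y\<close>. Thus
  \<open>oriented_line q u\<close> is unchanged when \<open>u\<close> is rescaled by a positive factor. It is an
  oriented line only for \<open>u \<noteq> 0\<close>.\<close>

definition oriented_line :: "'a::euclidean_space \<Rightarrow> 'a \<Rightarrow> ('a \<times> 'a) set" where
  "oriented_line q u = {(q + s *\<^sub>R u, q + t *\<^sub>R u) | s t. s < t}"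

definition outgoing_lines :: "'a::euclidean_space set \<Rightarrow> 'a \<Rightarrow> ('a \<times> 'a) set set" where
  "outgoing_lines K q = {oriented_line q u | u. u \<bullet> exterior_unit_normal K q > 0}"

definition map_oriented_line :: "('a \<Rightarrow> 'a) \<Rightarrow> ('a \<times> 'a) set \<Rightarrow> ('a \<times> 'a) set" where
  "map_oriented_line f L = map_prod f f ` L"


section \<open>The T-billiard reflection\<close>

text \<open>The boundary point of \<open>T\<close> whose exterior normal is co-directed with the oriented
  line \<open>L\<close> through \<open>q\<close>.\<close>

definition codirected_point ::
    "'a::euclidean_space set \<Rightarrow> 'a \<Rightarrow> ('a \<times> 'a) set \<Rightarrow> 'a" where
  "codirected_point T q L =
     (THE p. p \<in> frontier T \<and> L = oriented_line q (exterior_unit_normal T p))"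

definition second_intersection :: "'a::euclidean_space set \<Rightarrow> 'a \<Rightarrow> 'a \<Rightarrow> 'a" where
  "second_intersection T p v =
     (THE p'. p' \<in> frontier T \<and> p' \<noteq> p \<and> (\<exists>s\<ge>0. p' = p + s *\<^sub>R v))"

definition T_reflection ::
    "'a::euclidean_space set \<Rightarrow> 'a set \<Rightarrow> 'a \<Rightarrow> ('a \<times> 'a) set \<Rightarrow> ('a \<times> 'a) set" where
  "T_reflection T K q L =
     (let p0 = codirected_point T q L;
          p1 = second_intersection T p0 (- exterior_unit_normal K q)
      in oriented_line q (exterior_unit_normal T p1))"


section \<open>Projective billiards\<close>

text \<open>A line field assigns to a point \<open>Q\<close> of \<open>C\<close> a line through \<open>Q\<close>, as a subset of the
  ambient space; its values outside \<open>C\<close> are irrelevant.\<close>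

definition transversal_line_field ::
    "'a::euclidean_space set \<Rightarrow> ('a \<Rightarrow> 'a set) \<Rightarrow> bool" where
  "transversal_line_field C N \<longleftrightarrow>
     (\<forall>Q\<in>C. affine (N Q) \<and> aff_dim (N Q) = 1 \<and> Q \<in> N Q \<and>
            N Q \<inter> tangent_hyperplane C Q = {Q})"

definition projective_billiard ::
    "'a::euclidean_space set \<Rightarrow> ('a \<Rightarrow> 'a set) \<Rightarrow> bool" where
  "projective_billiard C N \<longleftrightarrow> smooth_hypersurface C \<and> transversal_line_field C N"

definition reflection_involution ::
    "'a::euclidean_space set \<Rightarrow> ('a \<Rightarrow> 'a set) \<Rightarrow> 'a \<Rightarrow> 'a \<Rightarrow> 'a" where
  "reflection_involution C N Q =
     (THE \<sigma>. affine_map \<sigma> \<and> (\<forall>x\<in>tangent_hyperplane C Q. \<sigma> x = x) \<and>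
        (\<forall>x\<in>N Q. \<sigma> x = 2 *\<^sub>R Q - x))"

definition projective_reflection ::
    "'a::euclidean_space set \<Rightarrow> ('a \<Rightarrow> 'a set) \<Rightarrow> 'a \<Rightarrow> ('a \<times> 'a) set \<Rightarrow> ('a \<times> 'a) set" where
  "projective_reflection C N Q L = map_oriented_line (reflection_involution C N Q) L"

text \<open>Lines of the field are point sets through \<open>Q\<close>, so for affine \<open>F\<close> the image of the
  direction of \<open>N Q\<close> under \<open>dF\<close>, placed at \<open>F Q\<close>, is \<open>F ` N Q\<close>.\<close>

definition affinely_Euclidean ::
    "'a::euclidean_space set \<Rightarrow> ('a \<Rightarrow> 'a set) \<Rightarrow> bool" where
  "affinely_Euclidean C N \<longleftrightarrow>
     (\<exists>F. affine_transformation F \<and> (\<forall>Q\<in>C. F ` N Q = normal_line (F ` C) (F Q)))"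

end

theory Submission
  imports Defs
begin

text \<open>Write \<open>T = F(ball 0 1)\<close> with \<open>F x = A x + b\<close>, let \<open>A\<^sup>*\<close> be the adjoint of \<open>A\<close> and \<open>B\<close> the
  inverse of \<open>A\<^sup>*\<close>. The exterior normal of \<open>T\<close> at \<open>F y\<close> is directed by \<open>B y\<close>, so the point
  codirected with \<open>u\<close> is \<open>F y\<close> with \<open>y\<close> proportional to \<open>A\<^sup>* u\<close>. Moving along \<open>- m\<close>, where \<open>m\<close> is the
  exterior normal of \<open>K\<close>, reflects \<open>y\<close> on the unit sphere in the hyperplane orthogonal to
  \<open>a = A\<^sup>-\<^sup>1 m\<close>. Carried back by \<open>B\<close>, this is the linear reflection of \<open>u\<close> that fixes the hyperplane
  orthogonal to \<open>m\<close> and negates \<open>B a\<close>: the line field is directed by \<open>B a\<close>. The map \<open>A\<^sup>*\<close> takes \<open>B a\<close>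
  to \<open>a\<close> and the tangent space of the boundary of \<open>K\<close> to the orthogonal complement of \<open>a\<close>, hence
  makes the billiard Euclidean.\<close>

section \<open>Tangent spaces of level sets and smooth hypersurfaces\<close>

lemma orthogonal_comp_hyperplane:
  fixes w :: "'a::euclidean_space"
  assumes "w \<noteq> 0"
  shows "orthogonal_comp {v. v \<bullet> w = 0} = range (\<lambda>s. s *\<^sub>R w)"
proof (intro set_eqI iffI)
  fix x assume x: "x \<in> orthogonal_comp {v. v \<bullet> w = 0}"
  define c where "c = (x \<bullet> w) / (w \<bullet> w)"
  define v where "v = x - c *\<^sub>R w"
  have vw: "v \<bullet> w = 0"
    using assms by (simp add: v_def c_def inner_diff_left)
  then have "x \<bullet> v = 0"
    using x by (auto simp: orthogonal_comp_def orthogonal_def inner_commute)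
  then have "v \<bullet> v = 0"
    using vw unfolding v_def by (simp add: inner_diff_left inner_diff_right inner_commute)
  then have "x = c *\<^sub>R w" by (simp add: v_def)
  then show "x \<in> range (\<lambda>s. s *\<^sub>R w)" by blast
qed (auto simp: orthogonal_comp_def orthogonal_def inner_commute)

text \<open>Velocities are orthogonal to the gradient \<open>w\<close> by the chain rule, since
  \<open>\<rho>\<close> vanishes along the curve near \<open>0\<close>. Conversely, nearest-point
  projection onto \<open>C\<close> yields a curve with prescribed velocity: the intermediate value
  theorem does the work of the implicit function theorem, and \<open>\<gamma>\<close> has to be
  differentiable only at the base point.\<close>

lemma tangent_space_level_set:
  fixes \<rho> :: "'a::euclidean_space \<Rightarrow> real"
  assumes "closed C" "q \<in> C" and U: "open U" "q \<in> U"
    and CU: "C \<inter> U = {x\<in>U. \<rho> x = 0}" and cont: "continuous_on U \<rho>"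
    and der: "(\<rho> has_derivative (\<lambda>v. v \<bullet> w)) (at q)" and "w \<noteq> 0"
  shows "tangent_space C q = {v. v \<bullet> w = 0}"
proof (intro set_eqI iffI)
  fix v assume "v \<in> tangent_space C q"
  then obtain \<gamma> \<epsilon> where \<gamma>: "\<epsilon> > 0" "\<And>t::real. \<bar>t\<bar> < \<epsilon> \<Longrightarrow> \<gamma> t \<in> C" "\<gamma> 0 = q"
    "(\<gamma> has_vector_derivative v) (at 0)"
    by (auto simp: tangent_space_def)
  have "isCont \<gamma> 0"
    using \<gamma>(4) by (rule has_vector_derivative_continuous)
  then have "(\<gamma> \<longlongrightarrow> q) (at 0)"
    using \<gamma>(3) by (simp add: isCont_def)
  then have "\<forall>\<^sub>F t in at 0. \<gamma> t \<in> U"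
    using U by (auto dest: topological_tendstoD)
  moreover have "\<forall>\<^sub>F t in at 0. \<gamma> t \<in> C"
    unfolding eventually_at using \<gamma>(1,2) by (auto simp: dist_real_def)
  ultimately have ev: "\<forall>\<^sub>F t in at 0. \<rho> (\<gamma> t) = 0"
    by eventually_elim (use CU in blast)
  have "((\<rho> \<circ> \<gamma>) has_derivative ((\<lambda>v. v \<bullet> w) \<circ> (\<lambda>t. t *\<^sub>R v))) (at 0)"
    using \<gamma>(3,4) der by (intro diff_chain_at) (simp_all add: has_vector_derivative_def)
  then have "((\<lambda>t. \<rho> (\<gamma> t)) has_derivative (\<lambda>t. t * (v \<bullet> w))) (at 0)"
    by (simp add: o_def)
  moreover have "\<rho> (\<gamma> 0) = 0" using \<gamma>(3) CU U assms(2) by auto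
  ultimately have "((\<lambda>t. 0) has_derivative (\<lambda>t. t * (v \<bullet> w))) (at (0::real))"
    using has_derivative_transform_eventually[OF _ ev] by simp
  then have "(\<lambda>t. t * (v \<bullet> w)) = (\<lambda>t. 0)"
    by (rule has_derivative_unique) simp
  then show "v \<in> {v. v \<bullet> w = 0}" by (auto dest: fun_cong[of _ _ 1])
next
  fix v assume "v \<in> {v. v \<bullet> w = 0}"
  then have vw: "v \<bullet> w = 0" by simp
  \<comment> \<open>Projecting the tangent ray to the nearest point of \<open>C\<close> gives a curve with velocity \<open>v\<close>:
    \<open>\<rho>\<close> changes sign across the ray at distance \<open>o(t)\<close>.\<close>
  define \<gamma> where "\<gamma> t = closest_point C (q + t *\<^sub>R v)" for t :: real
  have "C \<noteq> {}" using assms by auto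
  then have \<gamma>C: "\<gamma> t \<in> C" for t
    unfolding \<gamma>_def using assms(1) by (intro closest_point_in_set)
  have \<gamma>0: "\<gamma> 0 = q" by (simp add: \<gamma>_def closest_point_self assms)
  have \<rho>q: "\<rho> q = 0" using CU U assms(2) by auto
  have "\<exists>d>0. \<forall>t. norm (t - 0) < d \<longrightarrow> norm (\<gamma> t - \<gamma> 0 - (t - 0) *\<^sub>R v) \<le> e * norm (t - 0)"
    if "e > 0" for e
  proof -
    \<comment> \<open>Points of \<open>C\<close> will be found at distance at most
      \<open>e' * \<bar>t\<bar> * norm w = e * \<bar>t\<bar>\<close> from
      \<open>q + t *\<^sub>R v\<close>. Here \<open>\<bar>t\<bar> * M\<close> bounds their distance
      to \<open>q\<close>, and \<open>\<epsilon>\<close> keeps the first-order error of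
      \<open>\<rho>\<close> within half of the main term
      \<open>e' * \<bar>t\<bar> * (w \<bullet> w)\<close>.\<close>
    define e' where "e' = e / norm w"
    have e': "e' > 0" using that assms by (simp add: e'_def)
    define M where "M = norm v + e' * norm w"
    have M: "M > 0" using e' assms by (simp add: M_def add_nonneg_pos)
    define \<epsilon> where "\<epsilon> = e' * (w \<bullet> w) / (2 * M)"
    have \<epsilon>: "\<epsilon> > 0" using e' M assms by (simp add: \<epsilon>_def)
    obtain \<delta> where \<delta>: "\<delta> > 0"
      "\<And>y. norm (y - q) < \<delta> \<Longrightarrow> norm (\<rho> y - \<rho> q - (y - q) \<bullet> w) \<le> \<epsilon> * norm (y - q)"
      using der \<epsilon> unfolding has_derivative_at_alt by meson
    obtain r where r: "r > 0" "ball q r \<subseteq> U" using U openE by blast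
    define d where "d = min \<delta> r / M"
    have "d > 0" using \<delta>(1) r M by (simp add: d_def)
    moreover have "norm (\<gamma> t - q - t *\<^sub>R v) \<le> e * \<bar>t\<bar>" if t: "\<bar>t\<bar> < d" for t
    proof -
      define z where "z s = q + (t *\<^sub>R v + s *\<^sub>R w)" for s :: real
      have tM: "\<bar>t\<bar> * M < \<delta>" "\<bar>t\<bar> * M < r"
        using t M by (simp_all add: d_def field_simps)
      have zn: "norm (z s - q) \<le> \<bar>t\<bar> * M" if "\<bar>s\<bar> \<le> e' * \<bar>t\<bar>" for s
      proof -
        have "norm (z s - q) \<le> \<bar>t\<bar> * norm v + \<bar>s\<bar> * norm w"
          unfolding z_def using norm_triangle_ineq[of "t *\<^sub>R v" "s *\<^sub>R w"] by simp
        also have "\<dots> \<le> \<bar>t\<bar> * norm v + (e' * \<bar>t\<bar>) * norm w"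
          using that by (intro add_left_mono mult_right_mono) auto
        finally show ?thesis by (simp add: M_def algebra_simps)
      qed
      have zU: "z s \<in> U" if "\<bar>s\<bar> \<le> e' * \<bar>t\<bar>" for s
        using zn[OF that] tM r by (auto simp: dist_norm norm_minus_commute)
      have \<rho>z: "\<bar>\<rho> (z s) - s * (w \<bullet> w)\<bar> \<le> e' * \<bar>t\<bar> * (w \<bullet> w) / 2" if "\<bar>s\<bar> \<le> e' * \<bar>t\<bar>" for s
      proof -
        have "(z s - q) \<bullet> w = s * (w \<bullet> w)"
          using vw by (simp add: z_def inner_add_left)
        then have "\<bar>\<rho> (z s) - s * (w \<bullet> w)\<bar> \<le> \<epsilon> * norm (z s - q)"
          using \<delta>(2)[of "z s"] zn[OF that] tM \<rho>q by simp
        also have "\<dots> \<le> \<epsilon> * (\<bar>t\<bar> * M)"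
          using zn[OF that] \<epsilon> by (intro mult_left_mono) auto
        also have "\<dots> = e' * \<bar>t\<bar> * (w \<bullet> w) / 2"
          using M by (simp add: \<epsilon>_def)
        finally show ?thesis .
      qed
      \<comment> \<open>At \<open>s = s0\<close> and \<open>s = - s0\<close> the main term
        \<open>s * (w \<bullet> w)\<close> dominates the error, so \<open>\<rho>\<close> has
        opposite weak signs at the two ends and vanishes somewhere in between.\<close>
      define s0 where "s0 = e' * \<bar>t\<bar>"
      have s0: "s0 \<ge> 0" using e' by (simp add: s0_def)
      then have s0w: "s0 * (w \<bullet> w) \<ge> 0" by simp
      have "\<rho> (z (- s0)) \<le> 0" "\<rho> (z s0) \<ge> 0"
      proof -
        have "\<bar>\<rho> (z (- s0)) - - s0 * (w \<bullet> w)\<bar> \<le> s0 * (w \<bullet> w) / 2"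
          "\<bar>\<rho> (z s0) - s0 * (w \<bullet> w)\<bar> \<le> s0 * (w \<bullet> w) / 2"
          using \<rho>z[of "- s0"] \<rho>z[of s0] s0 unfolding s0_def[symmetric] by simp_all
        with s0w show "\<rho> (z (- s0)) \<le> 0" "\<rho> (z s0) \<ge> 0"
          unfolding mult_minus_left abs_le_iff by linarith+
      qed
      moreover have "continuous_on {- s0..s0} (\<lambda>s. \<rho> (z s))"
      proof (rule continuous_on_compose2[OF cont])
        show "continuous_on {- s0..s0} z" unfolding z_def by (intro continuous_intros)
        show "z ` {- s0..s0} \<subseteq> U" using zU by (auto simp: s0_def abs_le_iff)
      qed
      ultimately obtain s where s: "- s0 \<le> s" "s \<le> s0" "\<rho> (z s) = 0"
        using IVT'[of "\<lambda>s. \<rho> (z s)" "- s0" 0 s0] s0 by auto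
      have s': "\<bar>s\<bar> \<le> e' * \<bar>t\<bar>" using s by (simp add: s0_def abs_le_iff)
      \<comment> \<open>This zero of \<open>\<rho>\<close> competes for the closest point, so
        \<open>\<gamma> t\<close> is no farther from \<open>q + t *\<^sub>R v\<close> than
        \<open>z s\<close> is.\<close>
      have "z s \<in> C" using zU[OF s'] s(3) CU by blast
      then have "dist (q + t *\<^sub>R v) (\<gamma> t) \<le> dist (q + t *\<^sub>R v) (z s)"
        unfolding \<gamma>_def by (rule closest_point_le[OF assms(1)])
      also have "\<dots> = \<bar>s\<bar> * norm w" by (simp add: z_def dist_norm)
      also have "\<dots> \<le> e' * \<bar>t\<bar> * norm w" using s' by (intro mult_right_mono) auto
      also have "\<dots> = e * \<bar>t\<bar>" using assms by (simp add: e'_def)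
      finally show ?thesis
        by (simp add: dist_norm norm_minus_commute algebra_simps)
    qed
    ultimately show ?thesis unfolding \<gamma>0 by auto
  qed
  then have "(\<gamma> has_vector_derivative v) (at 0)"
    unfolding has_vector_derivative_def has_derivative_at_alt
    by (simp add: bounded_linear_scaleR_left)
  then show "v \<in> tangent_space C q"
    unfolding tangent_space_def using \<gamma>C \<gamma>0 by (auto intro!: exI[of _ \<gamma>] exI[of _ "1::real"])
qed

lemma tangent_space_smooth_hypersurface:
  fixes C :: "'a::euclidean_space set"
  assumes "smooth_hypersurface C" "closed C" "q \<in> C"
  obtains w where "w \<noteq> 0" "tangent_space C q = {v. v \<bullet> w = 0}"
proof -
  obtain U \<rho> where U: "open U" "q \<in> U" and sm: "smooth_on U \<rho>"
    and CU: "C \<inter> U = {x\<in>U. \<rho> x = 0}" and nz: "frechet_derivative \<rho> (at q) \<noteq> (\<lambda>v. 0)"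
    using assms unfolding smooth_hypersurface_def by (metis IntI)
  have "Ck_on (Suc 0) \<rho> U" "Ck_on 0 \<rho> U" using sm by (simp_all only: smooth_on_def)
  then have "\<rho> differentiable (at q)" and cont: "continuous_on U \<rho>" using U by auto
  then have der: "(\<rho> has_derivative frechet_derivative \<rho> (at q)) (at q)"
    by (simp add: frechet_derivative_works)
  define D where "D = frechet_derivative \<rho> (at q)"
  \<comment> \<open>The gradient of \<open>\<rho>\<close> at \<open>q\<close>, representing the
    derivative as an inner product.\<close>
  define w where "w = (\<Sum>b\<in>Basis. D b *\<^sub>R b)"
  have "linear D" using der unfolding D_def by (rule has_derivative_linear)
  then have D: "D = (\<lambda>v. v \<bullet> w)"
    by (intro ext, subst euclidean_representation[symmetric])
      (simp add: w_def linear_sum linear_cmul inner_sum_right mult.commute del: euclidean_representation)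
  then have "w \<noteq> 0" using nz by (auto simp: D_def)
  moreover have "tangent_space C q = {v. v \<bullet> w = 0}"
    using der assms U CU cont \<open>w \<noteq> 0\<close> D by (intro tangent_space_level_set) (auto simp: D_def)
  ultimately show ?thesis by (rule that)
qed

section \<open>Exterior unit normals of convex sets\<close>

text \<open>Along a curve in the frontier the functional \<open>a\<close> has a local maximum at
  \<open>q\<close>, so its derivative vanishes there.\<close>

lemma tangent_space_frontier_orthogonal_support:
  fixes K :: "'a::euclidean_space set"
  assumes "\<forall>x\<in>K. a \<bullet> x \<le> a \<bullet> q" "v \<in> tangent_space (frontier K) q"
  shows "v \<bullet> a = 0"
proof -
  obtain \<gamma> \<epsilon> where \<gamma>: "\<epsilon> > 0" "\<And>t::real. \<bar>t\<bar> < \<epsilon> \<Longrightarrow> \<gamma> t \<in> frontier K" "\<gamma> 0 = q"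
    "(\<gamma> has_vector_derivative v) (at 0)"
    using assms(2) by (auto simp: tangent_space_def)
  have "closure K \<subseteq> {x. a \<bullet> x \<le> a \<bullet> q}"
    using assms(1) by (intro closure_minimal) (auto simp: closed_halfspace_le)
  then have "a \<bullet> \<gamma> t \<le> a \<bullet> \<gamma> 0" if "\<bar>t\<bar> < \<epsilon>" for t
    using \<gamma>(2)[OF that] \<gamma>(3) by (auto simp: frontier_def)
  moreover have "((\<lambda>t. a \<bullet> \<gamma> t) has_real_derivative (a \<bullet> v)) (at 0)"
    using \<gamma>(4) unfolding has_vector_derivative_def has_field_derivative_def
    by (auto intro!: derivative_eq_intros simp: mult.commute)
  ultimately have "a \<bullet> v = 0"
    using \<gamma>(1) by (intro DERIV_local_max[of _ _ 0 \<epsilon>]) auto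
  then show ?thesis by (simp add: inner_commute)
qed

text \<open>The orthogonal complement of the tangent space is the line of \<open>m\<close>, which
  leaves \<open>m\<close> and \<open>- m\<close> as unit candidates. Support puts the whole open ray
  along \<open>m\<close> outside the closure. The real work is to exclude \<open>- m\<close>, that
  is, to show that the inner normal ray does not leave the closure at once.\<close>

lemma exterior_unit_normal_eqI:
  fixes K :: "'a::euclidean_space set"
  assumes "convex K" "K \<noteq> {}" "q \<in> frontier K"
    and ts: "tangent_space (frontier K) q = {v. v \<bullet> m = 0}" and m: "norm m = 1"
    and supp: "\<forall>x\<in>K. m \<bullet> x < m \<bullet> q"
  shows "exterior_unit_normal K q = m"
  unfolding exterior_unit_normal_def
proof (rule the_equality)
  have m0: "m \<noteq> 0" using m by auto
  have oc: "orthogonal_comp (tangent_space (frontier K) q) = range (\<lambda>s. s *\<^sub>R m)"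
    unfolding ts by (rule orthogonal_comp_hyperplane[OF m0])
  have "closure K \<subseteq> {x. m \<bullet> x \<le> m \<bullet> q}"
    using supp by (intro closure_minimal) (auto simp: closed_halfspace_le less_imp_le)
  moreover have "m \<bullet> (q + t *\<^sub>R m) > m \<bullet> q" if "t > 0" for t
    using that m0 by (simp add: inner_add_right)
  ultimately have out: "q + t *\<^sub>R m \<notin> closure K" if "t > 0" for t
    using that by fastforce
  show "norm m = 1 \<and> m \<in> orthogonal_comp (tangent_space (frontier K) q) \<and>
    (\<exists>\<epsilon>>0. \<forall>t. 0 < t \<and> t < \<epsilon> \<longrightarrow> q + t *\<^sub>R m \<notin> closure K)"
    using m oc out by (auto intro!: exI[of _ 1] image_eqI[of _ _ 1])
  fix n assume n: "norm n = 1 \<and> n \<in> orthogonal_comp (tangent_space (frontier K) q) \<and>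
    (\<exists>\<epsilon>>0. \<forall>t. 0 < t \<and> t < \<epsilon> \<longrightarrow> q + t *\<^sub>R n \<notin> closure K)"
  then obtain s \<epsilon> where s: "n = s *\<^sub>R m" "\<epsilon> > 0"
    and n_out: "\<And>t. 0 < t \<Longrightarrow> t < \<epsilon> \<Longrightarrow> q + t *\<^sub>R n \<notin> closure K"
    unfolding oc by blast
  then have "\<bar>s\<bar> = 1" using n m by simp
  moreover have "s \<noteq> -1"
  proof
    assume "s = -1"
    then have nm: "n = - m" using s by simp
    \<comment> \<open>The inner normal ray would miss \<open>K\<close>; a hyperplane separating it from \<open>K\<close> contradicts
      that \<open>m\<close> is the only supporting direction at \<open>q\<close>.\<close>
    define R where "R = (\<lambda>t. q + t *\<^sub>R n) ` {0..}"
    have "K \<inter> R = {}"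
    proof (rule ccontr)
      assume "K \<inter> R \<noteq> {}"
      then obtain t where t: "t \<ge> 0" "q + t *\<^sub>R n \<in> K" by (auto simp: R_def)
      \<comment> \<open>By convexity the closure contains the segment from \<open>q\<close> to
        \<open>q + t *\<^sub>R n\<close>; the factor \<open>c\<close> picks a point of it so close
        to \<open>q\<close> that \<open>n_out\<close> applies.\<close>
      define c where "c = min (1/2) (\<epsilon> / (2 * (t + 1)))"
      have l: "c > 0" "c \<le> 1" "c * t < \<epsilon>"
      proof -
        show "c > 0" "c \<le> 1" using s(2) t by (auto simp: c_def)
        have "c * t \<le> \<epsilon> / (2 * (t + 1)) * t" using t by (intro mult_right_mono) (auto simp: c_def)
        also have "\<dots> < \<epsilon>" using t s(2) by (simp add: field_simps add_nonneg_pos)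
        finally show "c * t < \<epsilon>" .
      qed
      have "t \<noteq> 0" using t supp by auto
      have "(1 - c) *\<^sub>R q + c *\<^sub>R (q + t *\<^sub>R n) \<in> closure K"
        using t l assms(3) closure_subset[of K] convex_closure[OF assms(1)]
        by (intro convexD) (auto simp: frontier_def)
      then have "q + (c * t) *\<^sub>R n \<in> closure K" by (simp add: algebra_simps)
      then show False using n_out[of "c * t"] l t \<open>t \<noteq> 0\<close> by auto
    qed
    moreover have "convex R"
    proof -
      have "R = (+) q ` (\<lambda>t. t *\<^sub>R n) ` {0..}" by (auto simp: R_def image_image)
      then show ?thesis
        by (simp add: convex_translation_eq convex_linear_image linear_scaleR_left)
    qed
    moreover have "R \<noteq> {}" by (auto simp: R_def)
    ultimately obtain a b where a: "a \<noteq> 0" "\<forall>x\<in>K. a \<bullet> x \<le> b" "\<forall>x\<in>R. a \<bullet> x \<ge> b"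
      using separating_hyperplane_sets[OF assms(1) _ assms(2)] by metis
    have "a \<bullet> (q + t *\<^sub>R n) \<ge> b" if "t \<ge> 0" for t
      using a(3) that by (auto simp: R_def)
    from this[of 0] this[of 1] have q: "a \<bullet> q \<ge> b" "a \<bullet> (q + n) \<ge> b" by simp_all
    have "closure K \<subseteq> {x. a \<bullet> x \<le> b}"
      using a(2) by (intro closure_minimal) (auto simp: closed_halfspace_le)
    then have "a \<bullet> q = b" using q assms(3) by (auto simp: frontier_def)
    \<comment> \<open>The separating functional supports \<open>K\<close> at \<open>q\<close>, hence
      is a multiple of \<open>m\<close>. As it is nonnegative on \<open>n = - m\<close>, the factor
      is negative, which reverses the strict support inequality for \<open>m\<close>.\<close>
    then have "a \<in> orthogonal_comp (tangent_space (frontier K) q)"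
      using tangent_space_frontier_orthogonal_support[of K a q] a(2)
      by (auto simp: orthogonal_comp_def orthogonal_def inner_commute)
    then obtain c where c: "a = c *\<^sub>R m" unfolding oc by auto
    have "a \<bullet> n \<ge> 0" using q \<open>a \<bullet> q = b\<close> by (simp add: inner_add_right)
    then have "c < 0" using c a(1) nm m norm_eq_1[of m] by (auto simp: le_less)
    obtain x where "x \<in> K" using assms(2) by auto
    then have "c * (m \<bullet> x) \<le> c * (m \<bullet> q)" "m \<bullet> x < m \<bullet> q"
      using a(2) c \<open>a \<bullet> q = b\<close> supp by auto
    then show False using \<open>c < 0\<close> by (simp add: mult_le_cancel_left)
  qed
  ultimately have "s = 1" by linarith
  then show "n = m" using s by simp
qed

text \<open>Separating \<open>q\<close> from \<open>K\<close> gives a supporting functional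
  \<open>a\<close>. It is orthogonal to the tangent space, hence a multiple of \<open>w\<close>, and
  after normalisation it meets the criterion for the exterior normal.\<close>

lemma exterior_unit_normal_props:
  fixes K :: "'a::euclidean_space set"
  assumes "convex K" "open K" "q \<in> frontier K"
    and "w \<noteq> 0" and ts: "tangent_space (frontier K) q = {v. v \<bullet> w = 0}"
  shows "norm (exterior_unit_normal K q) = 1"
    "tangent_space (frontier K) q = {v. v \<bullet> exterior_unit_normal K q = 0}"
proof -
  have "K \<noteq> {}" using assms by auto
  have "q \<notin> K" using assms by (simp add: frontier_def interior_open)
  then obtain a b where a: "a \<noteq> 0" "\<forall>x\<in>K. a \<bullet> x \<le> b" "a \<bullet> q \<ge> b"
    using separating_hyperplane_sets[OF assms(1), of "{q}"] \<open>K \<noteq> {}\<close> by auto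
  have "closure K \<subseteq> {x. a \<bullet> x \<le> b}"
    using a(2) by (intro closure_minimal) (auto simp: closed_halfspace_le)
  then have aq: "a \<bullet> q = b" using a assms(3) by (auto simp: frontier_def)
  have "a \<in> orthogonal_comp (tangent_space (frontier K) q)"
    using tangent_space_frontier_orthogonal_support[of K a q] a(2) aq
    by (auto simp: orthogonal_comp_def orthogonal_def inner_commute)
  then obtain c where c: "a = c *\<^sub>R w"
    unfolding ts orthogonal_comp_hyperplane[OF assms(4)] by auto
  define m where "m = a /\<^sub>R norm a"
  have m: "norm m = 1" using a by (simp add: m_def)
  have tsm: "tangent_space (frontier K) q = {v. v \<bullet> m = 0}"
    using a(1) c unfolding ts by (auto simp: m_def)
  \<comment> \<open>Openness of \<open>K\<close> turns the weak support inequality into the strict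
    one.\<close>
  have "K = interior K" using assms by (simp add: interior_open)
  also have "\<dots> \<subseteq> interior {x. a \<bullet> x \<le> b}" using a by (intro interior_mono) auto
  also have "\<dots> = {x. a \<bullet> x < b}" using a by (simp add: interior_halfspace_le)
  finally have "\<forall>x\<in>K. m \<bullet> x < m \<bullet> q"
    using aq a(1) by (auto simp: m_def divide_inverse_commute[symmetric] divide_strict_right_mono)
  with exterior_unit_normal_eqI[OF assms(1) \<open>K \<noteq> {}\<close> assms(3) tsm m]
  have "exterior_unit_normal K q = m" .
  then show "norm (exterior_unit_normal K q) = 1"
    "tangent_space (frontier K) q = {v. v \<bullet> exterior_unit_normal K q = 0}"
    using m tsm by auto
qed

section \<open>Oriented lines and the unit sphere\<close>

lemma oriented_line_eq_iff:
  assumes "u \<noteq> 0"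
  shows "oriented_line q u = oriented_line q u' \<longleftrightarrow> (\<exists>c>0. u' = c *\<^sub>R u)"
proof
  assume "oriented_line q u = oriented_line q u'"
  \<comment> \<open>The single ordered pair \<open>(q, q + u)\<close> already determines the
    direction up to a positive factor.\<close>
  moreover have "(q + 0 *\<^sub>R u, q + 1 *\<^sub>R u) \<in> oriented_line q u"
    unfolding oriented_line_def by (intro CollectI exI conjI) (rule refl, simp)
  ultimately obtain s t where "q = q + s *\<^sub>R u'" "q + u = q + t *\<^sub>R u'" "s < t"
    by (auto simp: oriented_line_def)
  with assms have "t > 0" "u' = (1 / t) *\<^sub>R u" by auto
  then show "\<exists>c>0. u' = c *\<^sub>R u" by (intro exI[of _ "1 / t"]) auto
next
  assume "\<exists>c>0. u' = c *\<^sub>R u"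
  then obtain c where c: "c > 0" "u' = c *\<^sub>R u" by auto
  show "oriented_line q u = oriented_line q u'"
  proof (intro set_eqI iffI)
    fix x assume "x \<in> oriented_line q u"
    then obtain s t where "x = (q + s *\<^sub>R u, q + t *\<^sub>R u)" "s < t"
      by (auto simp: oriented_line_def)
    with c have "x = (q + (s / c) *\<^sub>R u', q + (t / c) *\<^sub>R u') \<and> s / c < t / c"
      by (simp add: divide_strict_right_mono)
    then show "x \<in> oriented_line q u'" unfolding oriented_line_def by blast
  next
    fix x assume "x \<in> oriented_line q u'"
    then obtain s t where "x = (q + s *\<^sub>R u', q + t *\<^sub>R u')" "s < t"
      by (auto simp: oriented_line_def)
    with c have "x = (q + (s * c) *\<^sub>R u, q + (t * c) *\<^sub>R u) \<and> s * c < t * c"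
      by simp
    then show "x \<in> oriented_line q u" unfolding oriented_line_def by blast
  qed
qed

lemma tangent_space_sphere:
  fixes y :: "'a::euclidean_space"
  assumes "norm y = 1"
  shows "tangent_space (sphere 0 1) y = {v. v \<bullet> y = 0}"
proof -
  have "tangent_space (sphere 0 1) y = {v. v \<bullet> (2 *\<^sub>R y) = 0}"
  proof (rule tangent_space_level_set[where U = UNIV and \<rho> = "\<lambda>x. x \<bullet> x - 1"])
    show "sphere 0 1 \<inter> UNIV = {x \<in> UNIV. x \<bullet> x - 1 = (0::real)}"
      by (auto simp: norm_eq_1)
    show "((\<lambda>x. x \<bullet> x - 1) has_derivative (\<lambda>v. v \<bullet> (2 *\<^sub>R y))) (at y)"
      by (auto intro!: derivative_eq_intros simp: inner_commute)
  qed (use assms in \<open>auto intro!: continuous_intros\<close>)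
  then show ?thesis by simp
qed

section \<open>Linear isomorphisms and their adjoints\<close>

text \<open>The inverse is a parameter, so that every result also applies to the inverse, the
  adjoint and the inverse of the adjoint.\<close>

locale linear_iso =
  fixes A A' :: "'a::euclidean_space \<Rightarrow> 'a"
  assumes linear: "linear A" and inverse [simp]: "A (A' x) = x" "A' (A x) = x"
begin

lemma inj: "inj A" by (metis injI inverse(2))

lemma surj: "surj A" by (metis surjI inverse(1))

lemma bij_affine: "bij (\<lambda>x. A x + b)"
  by (rule bijI') (auto simp: inj_eq[OF inj] intro: exI[of _ "A' (_ - b)"])

lemma linear_inverse: "linear A'"
proof (rule linearI)
  fix x y c
  have "A (A' x + A' y) = x + y" "A (c *\<^sub>R A' x) = c *\<^sub>R x"
    by (simp_all add: linear_add[OF linear] linear_cmul[OF linear])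
  then show "A' (x + y) = A' x + A' y" "A' (c *\<^sub>R x) = c *\<^sub>R A' x"
    by (metis inverse(2))+
qed

lemma symmetric: "linear_iso A' A"
  by (rule linear_iso.intro) (simp_all add: linear_inverse)

lemma adjoint_inverse: "adjoint A' (adjoint A u) = u"
proof (rule vector_eq_ldot[THEN iffD1], rule allI)
  fix x show "x \<bullet> adjoint A' (adjoint A u) = x \<bullet> u"
    by (simp add: adjoint_works linear linear_inverse)
qed

lemma adjoint: "linear_iso (adjoint A) (adjoint A')"
  by (rule linear_iso.intro)
    (simp_all add: adjoint_linear linear adjoint_inverse linear_iso.adjoint_inverse[OF symmetric])

lemma zero_iff: "A x = 0 \<longleftrightarrow> x = 0"
  by (metis inverse(2) linear linear_0)

lemma tangent_space_affine_image:
  "tangent_space ((\<lambda>x. A x + b) ` C) (A q + b) = A ` tangent_space C q"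
proof (intro set_eqI iffI)
  fix v assume "v \<in> tangent_space ((\<lambda>x. A x + b) ` C) (A q + b)"
  then obtain \<gamma> \<epsilon> where \<gamma>: "\<epsilon> > 0" "\<And>t::real. \<bar>t\<bar> < \<epsilon> \<Longrightarrow> \<gamma> t \<in> (\<lambda>x. A x + b) ` C"
    "\<gamma> 0 = A q + b" "(\<gamma> has_vector_derivative v) (at 0)"
    by (auto simp: tangent_space_def)
  have bl: "bounded_linear A'" using linear_inverse by (simp add: linear_conv_bounded_linear)
  have "((\<lambda>t. A' (\<gamma> t - b)) has_vector_derivative A' v) (at 0)"
    using \<gamma>(4) by (intro bounded_linear.has_vector_derivative[OF bl]) (auto intro!: derivative_eq_intros)
  moreover have "A' (\<gamma> t - b) \<in> C" if "\<bar>t\<bar> < \<epsilon>" for t using \<gamma>(2)[OF that] by auto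
  moreover have "A' (\<gamma> 0 - b) = q" using \<gamma>(3) by simp
  ultimately have "A' v \<in> tangent_space C q"
    unfolding tangent_space_def using \<gamma>(1) by (auto intro!: exI[of _ "\<lambda>t. A' (\<gamma> t - b)"])
  then show "v \<in> A ` tangent_space C q" by (metis image_eqI inverse(1))
next
  fix v assume "v \<in> A ` tangent_space C q"
  then obtain v' \<gamma> \<epsilon> where v: "v = A v'" and \<gamma>: "\<epsilon> > 0" "\<And>t::real. \<bar>t\<bar> < \<epsilon> \<Longrightarrow> \<gamma> t \<in> C"
    "\<gamma> 0 = q" "(\<gamma> has_vector_derivative v') (at 0)"
    by (auto simp: tangent_space_def)
  have bl: "bounded_linear A" using linear by (simp add: linear_conv_bounded_linear)
  have "((\<lambda>t. A (\<gamma> t) + b) has_vector_derivative A v') (at 0)"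
    using bounded_linear.has_vector_derivative[OF bl \<gamma>(4)] by (auto intro!: derivative_eq_intros)
  then show "v \<in> tangent_space ((\<lambda>x. A x + b) ` C) (A q + b)"
    unfolding tangent_space_def v using \<gamma> by (auto intro!: exI[of _ "\<lambda>t. A (\<gamma> t) + b"])
qed

text \<open>Normals transform by the inverse transpose:
  \<open>A' v \<bullet> w = v \<bullet> adjoint A' w\<close>.\<close>

lemma image_hyperplane: "A ` {v. v \<bullet> w = 0} = {v. v \<bullet> adjoint A' w = 0}"
proof (intro set_eqI iffI)
  fix v assume "v \<in> {v. v \<bullet> adjoint A' w = 0}"
  then have "A' v \<bullet> w = 0" by (simp add: adjoint_works linear_inverse)
  then show "v \<in> A ` {v. v \<bullet> w = 0}" by (metis (mono_tags, lifting) image_eqI inverse(1) mem_Collect_eq)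
qed (auto simp: adjoint_works linear_inverse)

section \<open>Boundary geometry of ellipsoids\<close>

lemma open_affine_image_ball: "open ((\<lambda>x. A x + b) ` ball 0 1)"
proof -
  have "(\<lambda>x. A x + b) ` ball 0 1 = (+) b ` A ` ball 0 1" by (auto simp: image_image add.commute)
  then show ?thesis
    by (simp add: open_translation open_surjective_linear_image[OF open_ball linear surj])
qed

lemma frontier_affine_image_ball: "frontier ((\<lambda>x. A x + b) ` ball 0 1) = (\<lambda>x. A x + b) ` sphere 0 1"
proof -
  have split: "(\<lambda>x. A x + b) ` S = (+) b ` A ` S" for S
    by (auto simp: image_image add.commute)
  have "closure ((\<lambda>x. A x + b) ` ball 0 1) = (\<lambda>x. A x + b) ` cball 0 1"
    unfolding split closure_translation closure_injective_linear_image[OF linear inj, symmetric]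
    by simp
  moreover have "(\<lambda>x. A x + b) ` cball 0 1 - (\<lambda>x. A x + b) ` ball 0 1 = (\<lambda>x. A x + b) ` (cball 0 1 - ball 0 1)"
    using bij_affine by (intro image_set_diff[symmetric]) (rule bij_is_inj)
  moreover have "cball 0 1 - ball 0 1 = sphere (0::'a) 1" by auto
  ultimately show ?thesis
    by (simp add: frontier_def interior_open open_affine_image_ball)
qed

text \<open>The inverse transpose carries the normal \<open>y\<close> of the sphere to a normal of
  the ellipsoid, and the support inequality pulls back to the one of the unit ball, which is
  Cauchy-Schwarz.\<close>

lemma exterior_unit_normal_affine_image_ball:
  assumes "norm y = 1"
  shows "exterior_unit_normal ((\<lambda>x. A x + b) ` ball 0 1) (A y + b) = adjoint A' y /\<^sub>R norm (adjoint A' y)"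
proof (rule exterior_unit_normal_eqI)
  interpret adj': linear_iso "adjoint A'" "adjoint A"
    by (rule linear_iso.adjoint[OF symmetric])
  have "y \<noteq> 0" using assms by auto
  then have B0: "norm (adjoint A' y) > 0" by (simp add: adj'.zero_iff)
  then show "norm (adjoint A' y /\<^sub>R norm (adjoint A' y)) = 1" by simp
  have "(\<lambda>x. A x + b) ` ball 0 1 = (+) b ` A ` ball 0 1" by (auto simp: image_image add.commute)
  then show "convex ((\<lambda>x. A x + b) ` ball 0 1)"
    by (simp add: convex_translation_eq convex_linear_image linear)
  show "(\<lambda>x. A x + b) ` ball 0 1 \<noteq> {}" by simp
  show "A y + b \<in> frontier ((\<lambda>x. A x + b) ` ball 0 1)"
    using assms unfolding frontier_affine_image_ball by auto
  show "tangent_space (frontier ((\<lambda>x. A x + b) ` ball 0 1)) (A y + b) =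
    {v. v \<bullet> (adjoint A' y /\<^sub>R norm (adjoint A' y)) = 0}"
    using B0 by (simp add: frontier_affine_image_ball tangent_space_affine_image
        tangent_space_sphere[OF assms] image_hyperplane)
  have "y \<bullet> x < y \<bullet> y" if "norm x < 1" for x
    using norm_cauchy_schwarz[of y x] that assms norm_eq_1[of y] by simp
  then show "\<forall>x\<in>(\<lambda>x. A x + b) ` ball 0 1. (adjoint A' y /\<^sub>R norm (adjoint A' y)) \<bullet> x
      < (adjoint A' y /\<^sub>R norm (adjoint A' y)) \<bullet> (A y + b)"
    using B0 by (auto simp: linear_add[OF linear_inverse] inner_add_right adjoint_clauses
        linear_inverse distrib_left)
qed

text \<open>Since \<open>adjoint A'\<close> inverts \<open>adjoint A\<close>, the normal at the
  image of \<open>z\<close> is codirected with \<open>u\<close> exactly when \<open>z\<close> is a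
  positive multiple of \<open>adjoint A u\<close>; the condition \<open>norm z = 1\<close> then
  fixes the factor.\<close>

lemma codirected_point_affine_image_ball:
  assumes "u \<noteq> 0"
  shows "codirected_point ((\<lambda>x. A x + b) ` ball 0 1) q (oriented_line q u)
    = A (adjoint A u /\<^sub>R norm (adjoint A u)) + b"
  unfolding codirected_point_def
proof (rule the_equality)
  let ?T = "(\<lambda>x. A x + b) ` ball 0 1"
  interpret adj: linear_iso "adjoint A" "adjoint A'" by (rule adjoint)
  define y where "y = adjoint A u /\<^sub>R norm (adjoint A u)"
  have A0: "norm (adjoint A u) > 0" using assms by (simp add: adj.zero_iff)
  then have y: "norm y = 1" by (simp add: y_def)
  have By: "adjoint A' y = u /\<^sub>R norm (adjoint A u)"
    by (simp add: y_def linear_cmul[OF adj.linear_inverse])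
  have "oriented_line q u = oriented_line q (exterior_unit_normal ?T (A y + b))"
    unfolding exterior_unit_normal_affine_image_ball[OF y] oriented_line_eq_iff[OF assms] By
    using assms A0 by (auto intro!: exI[of _ "1 / norm u"] simp: field_simps)
  then show "A (adjoint A u /\<^sub>R norm (adjoint A u)) + b \<in> frontier ?T \<and> oriented_line q u
      = oriented_line q (exterior_unit_normal ?T (A (adjoint A u /\<^sub>R norm (adjoint A u)) + b))"
    using y unfolding frontier_affine_image_ball y_def[symmetric] by auto
  fix p assume "p \<in> frontier ?T \<and> oriented_line q u = oriented_line q (exterior_unit_normal ?T p)"
  then obtain z c where z: "p = A z + b" "norm z = 1" "c > 0" "adjoint A' z /\<^sub>R norm (adjoint A' z) = c *\<^sub>R u"
    unfolding frontier_affine_image_ball oriented_line_eq_iff[OF assms]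
    by (auto simp: exterior_unit_normal_affine_image_ball)
  \<comment> \<open>The factor \<open>k\<close> undoes the normalisation of the exterior normal, so
    that the linear map can be inverted.\<close>
  define k where "k = c * norm (adjoint A' z)"
  have "z \<noteq> 0" using z by auto
  then have "norm (adjoint A' z) > 0"
    using linear_iso.zero_iff[OF adj.symmetric] by simp
  then have "k > 0" "adjoint A' z = norm (adjoint A' z) *\<^sub>R (adjoint A' z /\<^sub>R norm (adjoint A' z))"
    using z(3) by (simp_all add: k_def)
  then have k: "k > 0" "adjoint A' z = k *\<^sub>R u"
    unfolding z(4) by (simp_all add: k_def mult.commute)
  then have zk: "z = k *\<^sub>R adjoint A u"
    by (metis adj.inverse(1) linear_cmul[OF adj.linear])
  with z k have "k * norm (adjoint A u) = 1" by simp
  then have "k = inverse (norm (adjoint A u))" by (metis inverse_unique mult.commute)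
  then show "p = A (adjoint A u /\<^sub>R norm (adjoint A u)) + b" using z zk by simp
qed

text \<open>Pulled back to the unit sphere, the ray runs from \<open>y\<close> along
  \<open>- A' m\<close>, and meeting the sphere is a quadratic equation with roots \<open>0\<close>
  and \<open>s0\<close>. The assumption on \<open>y \<bullet> A' m\<close> makes \<open>s0\<close>
  positive, so the second point lies on the ray; it is the mirror image of \<open>y\<close> in the
  hyperplane orthogonal to \<open>A' m\<close>.\<close>

lemma second_intersection_affine_image_ball:
  assumes y: "norm y = 1" and ya: "y \<bullet> A' m > 0"
  shows "second_intersection ((\<lambda>x. A x + b) ` ball 0 1) (A y + b) (- m)
    = A (y - (2 * (y \<bullet> A' m) / (A' m \<bullet> A' m)) *\<^sub>R A' m) + b"
  unfolding second_intersection_def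
proof (rule the_equality)
  define a where "a = A' m"
  have Aa: "A a = m" by (simp add: a_def)
  define s0 where "s0 = 2 * (y \<bullet> a) / (a \<bullet> a)"
  have "a \<noteq> 0" using ya by (auto simp: a_def)
  then have aa: "a \<bullet> a > 0" by simp
  have s0: "s0 > 0" using ya aa by (simp add: s0_def a_def)
  have yy: "y \<bullet> y = 1" using y by (simp add: norm_eq_1)
  have sph: "norm (y - s *\<^sub>R a) = 1 \<longleftrightarrow> s = 0 \<or> s = s0" for s
  proof -
    have "(y - s *\<^sub>R a) \<bullet> (y - s *\<^sub>R a) = 1 + s * (s * (a \<bullet> a) - 2 * (y \<bullet> a))"
      using yy by (simp add: inner_diff_left inner_diff_right inner_commute algebra_simps)
    then show ?thesis using aa by (auto simp: norm_eq_1 s0_def field_simps)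
  qed
  have lin: "A (y - s *\<^sub>R a) + b = A y + b + s *\<^sub>R (- m)" for s
    by (simp add: linear_diff[OF linear] linear_cmul[OF linear] Aa)
  have "A (y - s0 *\<^sub>R a) + b \<in> frontier ((\<lambda>x. A x + b) ` ball 0 1)"
    unfolding frontier_affine_image_ball using sph[of s0] by (intro imageI) simp
  moreover have "A (y - s0 *\<^sub>R a) + b \<noteq> A y + b"
    using s0 \<open>a \<noteq> 0\<close> by (simp add: inj_eq[OF inj])
  ultimately have "A (y - s0 *\<^sub>R a) + b \<in> frontier ((\<lambda>x. A x + b) ` ball 0 1) \<and>
    A (y - s0 *\<^sub>R a) + b \<noteq> A y + b \<and> (\<exists>s\<ge>0. A (y - s0 *\<^sub>R a) + b = A y + b + s *\<^sub>R (- m))"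
    using lin[of s0] less_imp_le[OF s0] by blast
  then show "A (y - (2 * (y \<bullet> A' m) / (A' m \<bullet> A' m)) *\<^sub>R A' m) + b \<in> frontier ((\<lambda>x. A x + b) ` ball 0 1) \<and>
    A (y - (2 * (y \<bullet> A' m) / (A' m \<bullet> A' m)) *\<^sub>R A' m) + b \<noteq> A y + b \<and>
    (\<exists>s\<ge>0. A (y - (2 * (y \<bullet> A' m) / (A' m \<bullet> A' m)) *\<^sub>R A' m) + b = A y + b + s *\<^sub>R (- m))"
    unfolding s0_def a_def .
  fix p assume p: "p \<in> frontier ((\<lambda>x. A x + b) ` ball 0 1) \<and> p \<noteq> A y + b \<and> (\<exists>s\<ge>0. p = A y + b + s *\<^sub>R (- m))"
  then obtain s z where s: "p = A y + b + s *\<^sub>R (- m)" and z: "p = A z + b" "norm z = 1"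
    unfolding frontier_affine_image_ball by auto
  have "A z + b = A (y - s *\<^sub>R a) + b" using s z lin[of s] by metis
  then have "z = y - s *\<^sub>R a" by (simp add: inj_eq[OF inj])
  then have "s = 0 \<or> s = s0" using sph z by metis
  then have "s = s0" using p s by auto
  then show "p = A (y - (2 * (y \<bullet> A' m) / (A' m \<bullet> A' m)) *\<^sub>R A' m) + b"
    using z \<open>z = y - s *\<^sub>R a\<close> by (simp add: s0_def a_def)
qed

section \<open>The billiard reflection of an ellipsoid\<close>

text \<open>The codirected point comes from the unit vector \<open>y\<close> along
  \<open>adjoint A u\<close>, the second intersection from its mirror image \<open>y1\<close>, and
  \<open>adjoint A'\<close> turns \<open>y1\<close> into the new direction. The identity
  \<open>adjoint A u \<bullet> A' m = u \<bullet> m\<close> translates being outgoing into the sign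
  condition on \<open>y\<close>.\<close>

lemma T_reflection_affine_image_ball:
  fixes K :: "'a set" and q :: 'a
  defines "m \<equiv> exterior_unit_normal K q"
  assumes um: "u \<bullet> m > 0"
  shows "T_reflection ((\<lambda>x. A x + b) ` ball 0 1) K q (oriented_line q u)
    = oriented_line q (u - (2 * (u \<bullet> m) / (A' m \<bullet> A' m)) *\<^sub>R adjoint A' (A' m))"
proof -
  let ?T = "(\<lambda>x. A x + b) ` ball 0 1"
  interpret adj: linear_iso "adjoint A" "adjoint A'" by (rule adjoint)
  define a k where "a = A' m" and "k = inverse (norm (adjoint A u))"
  define y where "y = k *\<^sub>R adjoint A u"
  define y1 where "y1 = y - (2 * (y \<bullet> a) / (a \<bullet> a)) *\<^sub>R a"
  define u1 where "u1 = u - (2 * (u \<bullet> m) / (a \<bullet> a)) *\<^sub>R adjoint A' a"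
  have "u \<noteq> 0" using um by auto
  then have k: "k > 0" "norm y = 1" by (simp_all add: k_def y_def adj.zero_iff)
  have "adjoint A u \<bullet> a = u \<bullet> m"
    by (simp add: a_def adjoint_clauses linear)
  then have ya: "y \<bullet> a = k * (u \<bullet> m)" by (simp add: y_def)
  then have ya0: "y \<bullet> a > 0" using k um by simp
  then have "a \<noteq> 0" by auto
  \<comment> \<open>The scaling \<open>k\<close> that normalised \<open>y\<close> passes through the
    linear reflection as a common positive factor, which oriented lines ignore.\<close>
  have By1: "adjoint A' y1 = k *\<^sub>R u1"
    unfolding y1_def u1_def ya
    by (simp add: y_def linear_diff[OF adj.linear_inverse] linear_cmul[OF adj.linear_inverse]
        scaleR_diff_right mult.assoc)
  \<comment> \<open>A reflection is an isometry, so \<open>y1\<close> is again on the sphere and the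
    formula for the exterior normal applies to it.\<close>
  have "y1 \<bullet> y1 = y \<bullet> y"
    using \<open>a \<noteq> 0\<close> by (simp add: y1_def inner_diff_left inner_diff_right inner_commute algebra_simps)
  then have y1: "norm y1 = 1" using k(2) by (simp add: norm_eq_1)
  then have "adjoint A' y1 \<noteq> 0" using linear_iso.zero_iff[OF adj.symmetric] by fastforce
  then have "u1 \<noteq> 0" "norm (adjoint A' y1) > 0" using By1 by auto
  then have "oriented_line q u1 = oriented_line q (adjoint A' y1 /\<^sub>R norm (adjoint A' y1))"
    unfolding oriented_line_eq_iff[OF \<open>u1 \<noteq> 0\<close>] using By1 k
    by (auto intro!: exI[of _ "k / norm (adjoint A' y1)"] simp: divide_inverse_commute)
  moreover have "T_reflection ?T K q (oriented_line q u)
      = oriented_line q (adjoint A' y1 /\<^sub>R norm (adjoint A' y1))"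
    unfolding T_reflection_def Let_def codirected_point_affine_image_ball[OF \<open>u \<noteq> 0\<close>]
    using second_intersection_affine_image_ball[OF k(2), of m b] ya0
      exterior_unit_normal_affine_image_ball[OF y1, of b]
    by (simp add: m_def[symmetric] y_def k_def y1_def a_def)
  ultimately show ?thesis by (simp add: u1_def a_def)
qed

end

section \<open>Reflection involutions of projective billiards\<close>

text \<open>As \<open>d\<close> is transversal to the tangent space, the two together span the whole
  space. An affine map fixing \<open>Q\<close> is determined by its linear part on them: the
  identity on the tangent space and \<open>- 1\<close> on \<open>d\<close>.\<close>

lemma reflection_involution_eq:
  fixes Q :: "'a::euclidean_space"
  assumes ts: "tangent_space C Q = {v. v \<bullet> m = 0}" and N: "N Q = (+) Q ` range (\<lambda>s. s *\<^sub>R d)"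
    and dm: "d \<bullet> m \<noteq> 0"
  shows "reflection_involution C N Q = (\<lambda>x. x - (2 * ((x - Q) \<bullet> m) / (d \<bullet> m)) *\<^sub>R d)"
  unfolding reflection_involution_def
proof (rule the_equality)
  define \<sigma> where "\<sigma> x = x - (2 * ((x - Q) \<bullet> m) / (d \<bullet> m)) *\<^sub>R d" for x
  have "linear (\<lambda>x. x - (2 * (x \<bullet> m) / (d \<bullet> m)) *\<^sub>R d)"
    by (rule linearI) (simp_all add: inner_add_left algebra_simps add_divide_distrib)
  moreover have "\<sigma> = (\<lambda>x. x - (2 * (x \<bullet> m) / (d \<bullet> m)) *\<^sub>R d + (2 * (Q \<bullet> m) / (d \<bullet> m)) *\<^sub>R d)"
    by (auto simp: \<sigma>_def fun_eq_iff inner_diff_left algebra_simps diff_divide_distrib)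
  ultimately have "affine_map \<sigma>"
    unfolding affine_map_def by (intro exI[of _ "\<lambda>x. x - (2 * (x \<bullet> m) / (d \<bullet> m)) *\<^sub>R d"] exI conjI)
  moreover have "\<sigma> x = 2 *\<^sub>R Q - x" if x: "x \<in> N Q" for x
  proof -
    obtain s where "x = Q + s *\<^sub>R d" using x by (auto simp: N)
    then have "\<sigma> x = Q + s *\<^sub>R d - (s + s) *\<^sub>R d" using dm by (simp add: \<sigma>_def)
    also have "\<dots> = 2 *\<^sub>R Q - x" unfolding \<open>x = Q + s *\<^sub>R d\<close> scaleR_left_distrib scaleR_2 by simp
    finally show ?thesis .
  qed
  ultimately show "affine_map (\<lambda>x. x - (2 * ((x - Q) \<bullet> m) / (d \<bullet> m)) *\<^sub>R d) \<and>
    (\<forall>x\<in>tangent_hyperplane C Q. x - (2 * ((x - Q) \<bullet> m) / (d \<bullet> m)) *\<^sub>R d = x) \<and>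
    (\<forall>x\<in>N Q. x - (2 * ((x - Q) \<bullet> m) / (d \<bullet> m)) *\<^sub>R d = 2 *\<^sub>R Q - x)"
    unfolding \<sigma>_def by (auto simp: tangent_hyperplane_def ts)
  fix \<tau> assume \<tau>: "affine_map \<tau> \<and> (\<forall>x\<in>tangent_hyperplane C Q. \<tau> x = x) \<and> (\<forall>x\<in>N Q. \<tau> x = 2 *\<^sub>R Q - x)"
  then obtain L b where L: "linear L" "\<tau> = (\<lambda>x. L x + b)" by (auto simp: affine_map_def)
  have "0 \<in> tangent_space C Q" by (simp add: ts)
  then have "Q \<in> tangent_hyperplane C Q" by (force simp: tangent_hyperplane_def)
  then have b: "L Q + b = Q" using \<tau> L by auto
  have Lt: "L v = v" if "v \<bullet> m = 0" for v
  proof -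
    have "Q + v \<in> tangent_hyperplane C Q" using that by (auto simp: tangent_hyperplane_def ts)
    then have "Q + v = L (Q + v) + b" using \<tau> L by auto
    also have "\<dots> = (L Q + b) + L v" by (simp add: linear_add[OF L(1)])
    finally show ?thesis using b by simp
  qed
  have "Q + 1 *\<^sub>R d \<in> N Q" unfolding N by blast
  then have "2 *\<^sub>R Q - (Q + d) = L (Q + d) + b" using \<tau> L by auto
  also have "\<dots> = (L Q + b) + L d" by (simp add: linear_add[OF L(1)])
  finally have "Q + - d = Q + L d" using b by (simp add: scaleR_2)
  then have Ld: "L d = - d" using add_left_imp_eq by metis
  show "\<tau> = (\<lambda>x. x - (2 * ((x - Q) \<bullet> m) / (d \<bullet> m)) *\<^sub>R d)"
  proof
    fix x
    \<comment> \<open>Splits \<open>x - Q\<close> into its component along \<open>d\<close> and a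
      tangent vector \<open>v\<close>.\<close>
    define c v where "c = ((x - Q) \<bullet> m) / (d \<bullet> m)" and "v = x - Q - c *\<^sub>R d"
    have "v \<bullet> m = 0" using dm by (simp add: v_def c_def inner_diff_left)
    then have "L v = v" by (rule Lt)
    have "x = Q + (v + c *\<^sub>R d)" by (simp add: v_def)
    then have "L x + b = (L Q + b) + (L v + c *\<^sub>R L d)"
      by (metis (no_types, lifting) L(1) add.assoc add.commute linear_add linear_cmul)
    also have "\<dots> = x - (2 * c) *\<^sub>R d"
      by (simp add: b Ld \<open>L v = v\<close>) (simp add: v_def scaleR_2 algebra_simps flip: scaleR_scaleR)
    finally show "\<tau> x = x - (2 * ((x - Q) \<bullet> m) / (d \<bullet> m)) *\<^sub>R d" by (simp add: L c_def)
  qed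
qed

text \<open>The involution is affine and fixes \<open>Q\<close>, so it acts on directions by its
  linear part and keeps the parameter \<open>s\<close>, hence also the order of points on the
  line.\<close>

lemma projective_reflection_eq:
  fixes Q :: "'a::euclidean_space"
  assumes "tangent_space C Q = {v. v \<bullet> m = 0}" "N Q = (+) Q ` range (\<lambda>s. s *\<^sub>R d)" "d \<bullet> m \<noteq> 0"
  shows "projective_reflection C N Q (oriented_line Q u)
    = oriented_line Q (u - (2 * (u \<bullet> m) / (d \<bullet> m)) *\<^sub>R d)"
proof -
  have r: "reflection_involution C N Q (Q + s *\<^sub>R u) = Q + s *\<^sub>R (u - (2 * (u \<bullet> m) / (d \<bullet> m)) *\<^sub>R d)" for s
    unfolding reflection_involution_eq[where N = N, OF assms] by (simp add: algebra_simps)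
  show ?thesis
    unfolding projective_reflection_def map_oriented_line_def oriented_line_def
    by (force simp: r image_iff)
qed

section \<open>The projective billiard structure on the boundary of \<open>K\<close>\<close>

theorem proposition1p8:
  fixes T K :: "(real ^ 'n) set"
  assumes "ellipsoid T"
    and "convex K" and "bounded K" and "open K"
    and "smooth_hypersurface (frontier K)"
  shows "\<exists>N. projective_billiard (frontier K) N \<and>
             (\<forall>q\<in>frontier K. \<forall>L\<in>outgoing_lines K q.
                T_reflection T K q L = projective_reflection (frontier K) N q L) \<and>
             affinely_Euclidean (frontier K) N"
proof -
  obtain F where F: "affine_map F" "bij F" "T = F ` ball 0 1"
    using assms(1) by (auto simp: ellipsoid_def affine_transformation_def)
  then obtain A b where "linear A" and F_eq: "F = (\<lambda>x. A x + b)"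
    by (auto simp only: affine_map_def)
  note A = \<open>linear A\<close> F(2)[unfolded F_eq] and T = F(3)[unfolded F_eq]
  \<comment> \<open>The linear part inherits bijectivity from the affine map: the preimage of
    \<open>x + b\<close> under the latter is a preimage of \<open>x\<close> under
    \<open>A\<close>.\<close>
  have "surj A"
  proof (rule surjI)
    fix x show "A (inv (\<lambda>x. A x + b) (x + b)) = x"
      using surj_f_inv_f[OF bij_is_surj[OF A(2)], of "x + b"] by simp
  qed
  moreover have "inj A" using bij_is_inj[OF A(2)] by (auto simp: inj_def)
  ultimately interpret linear_iso A "inv A"
    by (intro linear_iso.intro) (simp_all add: A surj_f_inv_f)
  interpret adj: linear_iso "adjoint A" "adjoint (inv A)" by (rule adjoint)
  define m where "m = exterior_unit_normal K"
  define d where "d q = adjoint (inv A) (inv A (m q))" for q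
  define N where "N q = (+) q ` range (\<lambda>s. s *\<^sub>R d q)" for q
  have m: "norm (m q) = 1" "tangent_space (frontier K) q = {v. v \<bullet> m q = 0}"
    if q: "q \<in> frontier K" for q
  proof -
    obtain w where w: "w \<noteq> 0" "tangent_space (frontier K) q = {v. v \<bullet> w = 0}"
      using tangent_space_smooth_hypersurface[OF assms(5) frontier_closed q] .
    show "norm (m q) = 1" "tangent_space (frontier K) q = {v. v \<bullet> m q = 0}"
      unfolding m_def by (fact exterior_unit_normal_props[OF assms(2,4) q w])+
  qed
  \<comment> \<open>This identity gives transversality, since the right side is positive for a
    nonzero normal, and it also matches the denominators of the two reflection formulas.\<close>
  have dm: "d q \<bullet> m q = inv A (m q) \<bullet> inv A (m q)" for q
    by (simp add: d_def adjoint_clauses linear_inverse)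
  have a0: "inv A (m q) \<noteq> 0" if "q \<in> frontier K" for q
    using m(1)[OF that] linear_iso.zero_iff[OF symmetric] by fastforce
  then have dm0: "d q \<bullet> m q \<noteq> 0" if "q \<in> frontier K" for q using that by (simp add: dm)
  have "transversal_line_field (frontier K) N"
    unfolding transversal_line_field_def
  proof
    fix q assume q: "q \<in> frontier K"
    have "d q \<noteq> 0" using dm0[OF q] by auto
    have rng: "range (\<lambda>s. s *\<^sub>R d q) = span {d q}" by (simp add: span_singleton)
    have "affine (N q)"
      unfolding N_def rng by (simp add: subspace_imp_affine affine_translation[symmetric])
    moreover have "aff_dim (N q) = 1"
      unfolding N_def rng using \<open>d q \<noteq> 0\<close> by (simp add: aff_dim_translation_eq aff_dim_subspace dim_span)
    moreover have "q \<in> N q" unfolding N_def by (auto simp: image_iff intro: exI[of _ 0])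
    moreover have "N q \<inter> tangent_hyperplane (frontier K) q = {q}"
      unfolding N_def tangent_hyperplane_def m(2)[OF q] using dm0[OF q] by (auto simp: image_iff intro: exI[of _ 0])
    ultimately show "affine (N q) \<and> aff_dim (N q) = 1 \<and> q \<in> N q \<and>
        N q \<inter> tangent_hyperplane (frontier K) q = {q}" by blast
  qed
  then have "projective_billiard (frontier K) N"
    using assms by (simp add: projective_billiard_def)
  moreover have "T_reflection T K q L = projective_reflection (frontier K) N q L"
    if q: "q \<in> frontier K" and L: "L \<in> outgoing_lines K q" for q L
  proof -
    obtain u where u: "L = oriented_line q u" "u \<bullet> m q > 0"
      using L by (auto simp: outgoing_lines_def m_def)
    have "T_reflection T K q L
        = oriented_line q (u - (2 * (u \<bullet> m q) / (inv A (m q) \<bullet> inv A (m q))) *\<^sub>R d q)"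
      using T_reflection_affine_image_ball[of u K q b] u(2) unfolding u(1) T m_def d_def by simp
    also have "\<dots> = projective_reflection (frontier K) N q L"
      unfolding u(1) dm[symmetric]
      using projective_reflection_eq[where N = N, OF m(2)[OF q] N_def dm0[OF q]] by simp
    finally show ?thesis .
  qed
  moreover have "affinely_Euclidean (frontier K) N"
    unfolding affinely_Euclidean_def
  proof (intro exI conjI ballI)
    have "bij (adjoint A)" using adj.bij_affine[of 0] by simp
    then show "affine_transformation (adjoint A)"
      unfolding affine_transformation_def affine_map_def
      using adj.linear by (auto intro!: exI[of _ "adjoint A"] exI[of _ 0])
    fix q assume q: "q \<in> frontier K"
    \<comment> \<open>Under \<open>adjoint A\<close> normals transform by the inverse transpose,
      which is \<open>inv A\<close>; the image hypersurface therefore has normal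
      \<open>inv A (m q)\<close>, and this is also the image of \<open>d q\<close>.\<close>
    have "adjoint (adjoint (inv A)) = inv A" by (rule adjoint_adjoint[OF linear_inverse])
    then have "tangent_space (adjoint A ` frontier K) (adjoint A q) = {v. v \<bullet> inv A (m q) = 0}"
      using adj.tangent_space_affine_image[of 0 "frontier K" q] adj.image_hyperplane[of "m q"] m(2)[OF q]
      by simp
    then have "normal_line (adjoint A ` frontier K) (adjoint A q)
        = (+) (adjoint A q) ` range (\<lambda>s. s *\<^sub>R inv A (m q))"
      by (simp add: normal_line_def orthogonal_comp_hyperplane[OF a0[OF q]])
    also have "\<dots> = adjoint A ` N q"
      by (simp add: N_def d_def image_image linear_add[OF adj.linear] linear_cmul[OF adj.linear])
    finally show "adjoint A ` N q = normal_line (adjoint A ` frontier K) (adjoint A q)" ..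
  qed
  ultimately show ?thesis by blast
qed

end
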